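(* There is a canonical one-to-one correspondence between functions from $(0,\infty)$ to the set $\mathbb N_1$ of all positive integers and all non-empty absolutely homogeneous ultrametric spaces (considered up to isometry). Precisely, each such a space $(Z,\rho)$ is isometric to a metric space of the form $$(\star)\qquad {}^{\geq}\!\prod^{*}_{t>0}(I_{f(t)},t\,\delta_{f(t)})$$ where $f\colon(0,\infty)\to\mathbb N_1$ is a function uniquely determined by $(Z,\rho)$. Conversely, for an arbitrary function $f\colon(0,\infty)\to\mathbb N_1$, the space of the form $(\star)$ is non-empty, ultrametric and absolutely homogeneous.
   Context: A metric space $(X,d)$ is ultrametric if $d(x,z)\leq\max(d(x,y),d(y,z))$ for all $x,y,z\in X$. A metric space is absolutely homogeneous if every isometric map from a subset of it into it extends to an isometry of the space onto itself. $I_n=\{1,\ldots,n\}$ and $\delta_n$ is the discrete metric on $I_n$ (distinct points are at distance $1$). The product ${}^{\geq}\!\prod^{*}_{t>0}(I_{f(t)},t\,\delta_{f(t)})$, taken with respect to the order $\geq$ on $(0,\infty)$ reverse to the natural one, is the pair $(W,\lambda)$ defined as follows: fix any $\mathfrak a=(a_t)_{t>0}\in\prod_{t>0}I_{f(t)}$; $W$ consists of all $\mathfrak x=(x_t)_{t>0}\in\prod_{t>0}I_{f(t)}$ such that the set $\{t>0: x_t\neq a_t\}$ is well-ordered with respect to the order $\geq$ (i.e., each its non-empty subset has a greatest real number); and for $\mathfrak x,\mathfrak y\in W$, $\lambda(\mathfrak x,\mathfrak x)=0$ and, for $\mathfrak x\neq\mathfrak y$, $\lambda(\mathfrak x,\mathfrak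 y)=\ell\,\delta_{f(\ell)}(x_\ell,y_\ell)=\ell$, where $\ell$ is the greatest real number in $\{t>0: x_t\neq y_t\}$. Up to isometry this does not depend on the choice of $\mathfrak a$. *)

theory Defs
  imports "HOL-Analysis.Analysis"
begin

definition ultrametric_space :: "'a set \<Rightarrow> ('a \<Rightarrow> 'a \<Rightarrow> real) \<Rightarrow> bool" where
  "ultrametric_space X d \<longleftrightarrow>
     Metric_space X d \<and> (\<forall>x\<in>X. \<forall>y\<in>X. \<forall>z\<in>X. d x z \<le> max (d x y) (d y z))"

text \<open>Isometric maps defined on a subset \<open>S\<close> of the first space; they need not be onto.\<close>

definition isometric_map ::
    "'a set \<Rightarrow> ('a \<Rightarrow> 'a \<Rightarrow> real) \<Rightarrow> 'b set \<Rightarrow> ('b \<Rightarrow> 'b \<Rightarrow> real) \<Rightarrow> ('a \<Rightarrow> 'b) \<Rightarrow> bool" where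
  "isometric_map S d Y e \<phi> \<longleftrightarrow>
     \<phi> \<in> S \<rightarrow> Y \<and> (\<forall>x\<in>S. \<forall>y\<in>S. e (\<phi> x) (\<phi> y) = d x y)"

definition isometry ::
    "'a set \<Rightarrow> ('a \<Rightarrow> 'a \<Rightarrow> real) \<Rightarrow> 'b set \<Rightarrow> ('b \<Rightarrow> 'b \<Rightarrow> real) \<Rightarrow> ('a \<Rightarrow> 'b) \<Rightarrow> bool" where
  "isometry X d Y e \<psi> \<longleftrightarrow> isometric_map X d Y e \<psi> \<and> bij_betw \<psi> X Y"

definition isometric_spaces ::
    "'a set \<times> ('a \<Rightarrow> 'a \<Rightarrow> real) \<Rightarrow> 'b set \<times> ('b \<Rightarrow> 'b \<Rightarrow> real) \<Rightarrow> bool" where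
  "isometric_spaces A B \<longleftrightarrow> (\<exists>\<psi>. isometry (fst A) (snd A) (fst B) (snd B) \<psi>)"

definition absolutely_homogeneous :: "'a set \<Rightarrow> ('a \<Rightarrow> 'a \<Rightarrow> real) \<Rightarrow> bool" where
  "absolutely_homogeneous X d \<longleftrightarrow>
     (\<forall>S \<phi>. S \<subseteq> X \<and> isometric_map S d X d \<phi> \<longrightarrow>
        (\<exists>\<psi>. isometry X d X d \<psi> \<and> (\<forall>x\<in>S. \<psi> x = \<phi> x)))"

definition AHU_spaces :: "('a set \<times> ('a \<Rightarrow> 'a \<Rightarrow> real)) set" where
  "AHU_spaces =
     {(X, d). X \<noteq> {} \<and> ultrametric_space X d \<and> absolutely_homogeneous X d}"

text \<open>
  Isometry classes are formed among the spaces carried by subsets of one type \<open>'a\<close>, as HOL has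
  no universe of all sets. Taking \<open>'a\<close> to be \<open>real \<Rightarrow> nat\<close>, where the products below live, loses
  nothing once every space, on whatever type, is shown isometric to such a product.
\<close>

definition AHU_isometry_rel ::
    "(('a set \<times> ('a \<Rightarrow> 'a \<Rightarrow> real)) \<times> ('a set \<times> ('a \<Rightarrow> 'a \<Rightarrow> real))) set" where
  "AHU_isometry_rel = {(A, B). A \<in> AHU_spaces \<and> B \<in> AHU_spaces \<and> isometric_spaces A B}"

text \<open>
  Functions from \<open>(0, \<infinity>)\<close> to the positive integers, and elements of \<open>\<Prod>\<^sub>t I\<^bsub>f t\<^esub>\<close>.
  Both are taken extensional (equal to \<open>undefined\<close> outside \<open>(0, \<infinity>)\<close>), so that equality
  in HOL is equality of functions on \<open>(0, \<infinity>)\<close>.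
\<close>

definition index_functions :: "(real \<Rightarrow> nat) set" where
  "index_functions = {0<..} \<rightarrow>\<^sub>E {1..}"

definition full_product :: "(real \<Rightarrow> nat) \<Rightarrow> (real \<Rightarrow> nat) set" where
  "full_product f = (\<Pi>\<^sub>E t\<in>{0<..}. {1..f t})"

definition well_ordered_ge :: "real set \<Rightarrow> bool" where
  "well_ordered_ge T \<longleftrightarrow> (\<forall>S. S \<subseteq> T \<and> S \<noteq> {} \<longrightarrow> (\<exists>m\<in>S. \<forall>s\<in>S. s \<le> m))"

definition product_carrier :: "(real \<Rightarrow> nat) \<Rightarrow> (real \<Rightarrow> nat) \<Rightarrow> (real \<Rightarrow> nat) set" where
  "product_carrier f a = {x \<in> full_product f. well_ordered_ge {t. t > 0 \<and> x t \<noteq> a t}}"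

text \<open>
  The value \<open>0\<close> off the carrier is a convention only: \<^locale>\<open>Metric_space\<close> requires distances to
  be nonnegative and symmetric on the whole type.
\<close>

definition product_dist ::
    "(real \<Rightarrow> nat) \<Rightarrow> (real \<Rightarrow> nat) \<Rightarrow> (real \<Rightarrow> nat) \<Rightarrow> (real \<Rightarrow> nat) \<Rightarrow> real" where
  "product_dist f a x y =
     (if x \<in> product_carrier f a \<and> y \<in> product_carrier f a \<and> x \<noteq> y
      then (let l = (GREATEST t. t > 0 \<and> x t \<noteq> y t) in l * discrete_metric.dd (x l) (y l))
      else 0)"

definition product_space ::
    "(real \<Rightarrow> nat) \<Rightarrow> (real \<Rightarrow> nat) \<Rightarrow> (real \<Rightarrow> nat) set \<times> ((real \<Rightarrow> nat) \<Rightarrow> (real \<Rightarrow> nat) \<Rightarrow> real)" where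
  "product_space f a = (product_carrier f a, product_dist f a)"

end

theory Submission
  imports Defs
begin

text \<open>
  Two properties pin an ultrametric space down. One is a \<^emph>\<open>branching number\<close>
  \<open>f t\<close> for each \<open>t > 0\<close>: every closed ball of radius \<open>t\<close> splits into
  exactly \<open>f t\<close> open balls of radius \<open>t\<close>. The other is
  \<^emph>\<open>pseudocompleteness\<close>: a family of distances \<open>r s\<close> to points \<open>s\<close> that
  has no smallest member and obeys the ultrametric law is realised by a point of the space. Call a
  nonempty space with both properties \<open>saturated\<close>.

  Between two saturated spaces with the same \<open>f\<close>, every partial isometry extends to one more
  point \<open>p\<close> (\<open>one_point_extension\<close>). If the distance from \<open>p\<close> to the domain is
  attained, with value \<open>r\<close>, then the open \<open>r\<close>-balls of the closed \<open>r\<close>-ball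
  around \<open>p\<close> that the domain meets are fewer than \<open>f r\<close>, so a free one is left on the other
  side; if it is not attained, pseudocompleteness supplies the image. Extending on both sides, Zorn's
  lemma makes every partial isometry part of an isometry onto. Hence a saturated space is absolutely
  homogeneous, and \<open>f\<close> determines it up to isometry; conversely \<open>f t\<close> is the largest
  size of a set with all mutual distances \<open>t\<close>, an isometry invariant.

  It remains to see that both kinds of spaces in question are saturated. For the products
  (\<open>product_saturated\<close>), the \<open>t\<close>-th coordinate separates the open balls of radius
  \<open>t\<close> inside a closed one, and a pseudolimit is glued from the coordinates on which the
  given points eventually agree; its set of differences from the base point is still well-ordered
  because any nonempty part of it has an upper section that comes from a single given point. For an
  absolutely homogeneous space (\<open>homogeneous_imp_saturated\<close>), transitivity makes the branching
  number independent of the ball. It is finite, since an infinite system of representatives would have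
  a non-surjective self-injection, which no isometry onto can extend. A pseudolimit is found by
  placing points at the prescribed distances around an arbitrary centre \<open>z\<close>, mapping them
  isometrically to the given ones, and taking the image of \<open>z\<close> under an extension.
\<close>

section \<open>Ultrametric preliminaries\<close>

lemma ultrametricD:
  assumes "ultrametric_space X d"
  shows "0 \<le> d x y" "d x y = d y x"
    and "x \<in> X \<Longrightarrow> y \<in> X \<Longrightarrow> d x y = 0 \<longleftrightarrow> x = y"
    and "x \<in> X \<Longrightarrow> y \<in> X \<Longrightarrow> z \<in> X \<Longrightarrow> d x z \<le> max (d x y) (d y z)"
  using assms
  by (auto simp: ultrametric_space_def Metric_space.nonneg Metric_space.commute Metric_space.zero)

lemma isosceles:
  assumes "ultrametric_space X d" "x \<in> X" "y \<in> X" "z \<in> X" "d x y < d y z"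
  shows "d x z = d y z"
  using ultrametricD(4)[OF assms(1), of x y z] ultrametricD(4)[OF assms(1), of y x z]
    ultrametricD(2)[OF assms(1), of x y] assms(2-5) by auto

lemma isometryD:
  assumes "isometry X d Y e \<psi>"
  shows "x \<in> X \<Longrightarrow> \<psi> x \<in> Y"
    and "x \<in> X \<Longrightarrow> y \<in> X \<Longrightarrow> e (\<psi> x) (\<psi> y) = d x y"
    and "b \<in> Y \<Longrightarrow> \<exists>x\<in>X. \<psi> x = b"
    and "inj_on \<psi> X"
  using assms unfolding isometry_def isometric_map_def bij_betw_def by (auto simp: image_iff)

definition equidistant :: "'a set \<Rightarrow> ('a \<Rightarrow> 'a \<Rightarrow> real) \<Rightarrow> real \<Rightarrow> 'a set \<Rightarrow> bool" where
  "equidistant X d t E \<longleftrightarrow> E \<subseteq> X \<and> (\<forall>x\<in>E. \<forall>y\<in>E. x \<noteq> y \<longrightarrow> d x y = t)"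

text \<open>
Being closer than \<open>t\<close> is an equivalence relation, and \<open>M\<close> picks one point in each of its
classes on \<open>T\<close>.
\<close>
lemma equidistant_net:
  assumes U: "ultrametric_space X d" and t: "0 < t" and T: "T \<subseteq> X"
    and diam: "\<And>x y. x \<in> T \<Longrightarrow> y \<in> T \<Longrightarrow> d x y \<le> t"
  obtains M where "M \<subseteq> T" "equidistant X d t M" "\<And>y. y \<in> T \<Longrightarrow> \<exists>m\<in>M. d m y < t"
proof -
  note u = ultrametricD[OF U]
  define rep where "rep y = (SOME w. w \<in> T \<and> d y w < t)" for y
  have rep: "rep y \<in> T \<and> d y (rep y) < t" if "y \<in> T" for y
    unfolding rep_def by (rule someI[of _ y]) (use that u(3)[of y y] t T in auto)
  have same: "rep x = rep y" if xy: "x \<in> T" "y \<in> T" and lt: "d (rep x) (rep y) < t" for x y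
  proof -
    have in_X: "x \<in> X" "y \<in> X" "rep x \<in> X" "rep y \<in> X" using rep xy T by auto
    have "d x (rep y) < t"
      using u(4)[of x "rep x" "rep y"] rep[OF xy(1)] lt in_X by auto
    hence "d x y < t"
      using u(4)[of x "rep y" y] rep[OF xy(2)] u(2)[of y "rep y"] in_X by auto
    hence "d x w < t \<longleftrightarrow> d y w < t" if "w \<in> T" for w
      using u(4)[of x y w] u(4)[of y x w] u(2)[of x y] in_X that T by auto
    hence "(\<lambda>w. w \<in> T \<and> d x w < t) = (\<lambda>w. w \<in> T \<and> d y w < t)" by auto
    thus ?thesis unfolding rep_def by simp
  qed
  show thesis
  proof
    show "rep ` T \<subseteq> T" using rep by auto
    show "equidistant X d t (rep ` T)"
      unfolding equidistant_def
    proof (intro conjI ballI impI)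
      show "rep ` T \<subseteq> X" using rep T by auto
      fix a b assume "a \<in> rep ` T" "b \<in> rep ` T" "a \<noteq> b"
      then obtain x y where "x \<in> T" "y \<in> T" "a = rep x" "b = rep y" by auto
      with same[of x y] diam[of a b] rep \<open>a \<noteq> b\<close> show "d a b = t" by force
    qed
    show "\<exists>m\<in>rep ` T. d m y < t" if "y \<in> T" for y
      using rep[OF that] u(2)[of y "rep y"] that by auto
  qed
qed

section \<open>Saturated ultrametric spaces\<close>

text \<open>
Counting open balls is replaced by counting equidistant sets: a set with mutual distances \<open>t\<close>
is a partial system of representatives for the open \<open>t\<close>-balls inside a closed one. The last
clause says that a partial system with fewer than \<open>f t\<close> members can be enlarged. In a nonempty
space \<open>f t\<close>, for \<open>t > 0\<close>, is thus positive and uniquely determined.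
\<close>
definition branching :: "'a set \<Rightarrow> ('a \<Rightarrow> 'a \<Rightarrow> real) \<Rightarrow> (real \<Rightarrow> nat) \<Rightarrow> bool" where
  "branching X d f \<longleftrightarrow>
     (\<forall>t>0. \<forall>E. E \<noteq> {} \<and> equidistant X d t E \<longrightarrow>
        finite E \<and> card E \<le> f t \<and> (card E < f t \<longrightarrow> (\<exists>q\<in>X. \<forall>y\<in>E. d q y = t)))"

text \<open>
A form of spherical completeness. The hypothesis on \<open>d s s'\<close> is what the isosceles law forces
on the distances \<open>r s\<close> from a point to the points of \<open>S\<close>; since \<open>r\<close> has no
minimum on \<open>S\<close>, the point sought lies in the intersection of a strictly shrinking chain of balls.
\<close>
definition pseudocomplete :: "'a set \<Rightarrow> ('a \<Rightarrow> 'a \<Rightarrow> real) \<Rightarrow> bool" where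
  "pseudocomplete X d \<longleftrightarrow>
     (\<forall>S r. S \<noteq> {} \<and> S \<subseteq> X \<and> (\<forall>s\<in>S. 0 < r s \<and> (\<exists>s'\<in>S. r s' < r s)) \<and>
        (\<forall>s\<in>S. \<forall>s'\<in>S. r s' < r s \<longrightarrow> d s s' = r s) \<longrightarrow>
        (\<exists>q\<in>X. \<forall>s\<in>S. d q s = r s))"

definition saturated :: "'a set \<Rightarrow> ('a \<Rightarrow> 'a \<Rightarrow> real) \<Rightarrow> (real \<Rightarrow> nat) \<Rightarrow> bool" where
  "saturated X d f \<longleftrightarrow>
     X \<noteq> {} \<and> ultrametric_space X d \<and> branching X d f \<and> pseudocomplete X d"

lemma branchingD:
  assumes "branching X d f" "0 < t" "E \<noteq> {}" "equidistant X d t E"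
  shows "finite E" "card E \<le> f t" "card E < f t \<Longrightarrow> \<exists>q\<in>X. \<forall>y\<in>E. d q y = t"
  using assms unfolding branching_def by blast+

lemma pseudocompleteD:
  assumes "pseudocomplete X d" "S \<noteq> {}" "S \<subseteq> X"
    and "\<And>s. s \<in> S \<Longrightarrow> 0 < r s" "\<And>s. s \<in> S \<Longrightarrow> \<exists>s'\<in>S. r s' < r s"
    and "\<And>s s'. s \<in> S \<Longrightarrow> s' \<in> S \<Longrightarrow> r s' < r s \<Longrightarrow> d s s' = r s"
  obtains q where "q \<in> X" "\<And>s. s \<in> S \<Longrightarrow> d q s = r s"
proof -
  have "\<exists>q\<in>X. \<forall>s\<in>S. d q s = r s"
    using assms(1)[unfolded pseudocomplete_def, rule_format, of S r] assms(2-6) by blast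
  thus thesis using that by blast
qed

lemma equidistant_of_full_size:
  assumes U: "ultrametric_space X d" and B: "branching X d f" and x: "x \<in> X" and t: "0 < t"
  obtains E where "E \<noteq> {}" "equidistant X d t E" "finite E" "card E = f t"
proof -
  have sing: "equidistant X d t {x}" using x by (simp add: equidistant_def)
  \<comment> \<open>starting from a single point, points are added one at a time until there are \<open>f t\<close>\<close>
  have "\<exists>E. E \<noteq> {} \<and> equidistant X d t E \<and> card E = n" if "1 \<le> n" "n \<le> f t" for n
    using that
  proof (induction n rule: dec_induct)
    case base
    show ?case using sing by (intro exI[of _ "{x}"]) auto
  next
    case (step n)
    then obtain E where E: "E \<noteq> {}" "equidistant X d t E" "card E = n" by auto
    with step branchingD[OF B t E(1,2)] obtain q where
      q: "q \<in> X" "\<And>y. y \<in> E \<Longrightarrow> d q y = t" and fin: "finite E" by auto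
    have "q \<notin> E" using q t ultrametricD(3)[OF U, of q q] by force
    moreover have "equidistant X d t (insert q E)"
      using E(2) q ultrametricD(2)[OF U] unfolding equidistant_def by (metis insert_iff subset_iff)
    ultimately show ?case using E(3) fin by (intro exI[of _ "insert q E"]) auto
  qed
  moreover have "1 \<le> f t" using branchingD(2)[OF B t _ sing] by simp
  ultimately show thesis using that branchingD(1)[OF B t] by (metis order_refl)
qed

lemma branching_numbers_le:
  assumes X: "saturated X d f" and Y: "branching Y e g"
    and \<psi>: "isometry X d Y e \<psi>" and t: "0 < t"
  shows "f t \<le> g t"
proof -
  have U: "ultrametric_space X d" and B: "branching X d f" and "X \<noteq> {}"
    using X by (auto simp: saturated_def)
  then obtain x where x: "x \<in> X" by blast
  obtain E where E: "E \<noteq> {}" "equidistant X d t E" "card E = f t"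
    by (rule equidistant_of_full_size[OF U B x t])
  have sub: "E \<subseteq> X" using E by (simp add: equidistant_def)
  have "equidistant Y e t (\<psi> ` E)"
    unfolding equidistant_def
  proof (intro conjI ballI impI)
    show "\<psi> ` E \<subseteq> Y" using isometryD(1)[OF \<psi>] sub by auto
    fix a b assume "a \<in> \<psi> ` E" "b \<in> \<psi> ` E" "a \<noteq> b"
    then obtain x y where "x \<in> E" "y \<in> E" "x \<noteq> y" "a = \<psi> x" "b = \<psi> y" by auto
    thus "e a b = t" using E(2) sub isometryD(2)[OF \<psi>] by (auto simp: equidistant_def subset_iff)
  qed
  moreover have "card (\<psi> ` E) = card E"
    using isometryD(4)[OF \<psi>] sub by (intro card_image) (rule inj_on_subset)
  ultimately show ?thesis using branchingD(2)[OF Y t, of "\<psi> ` E"] E by simp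
qed

section \<open>Extending partial isometries\<close>

text \<open>
Partial isometries are encoded by their graphs. This makes the notion symmetric in the two spaces, so
that extending the range is extending the domain of the converse, and turns unions of chains into plain
set unions.
\<close>
definition distance_preserving ::
    "'a set \<Rightarrow> ('a \<Rightarrow> 'a \<Rightarrow> real) \<Rightarrow> 'b set \<Rightarrow> ('b \<Rightarrow> 'b \<Rightarrow> real) \<Rightarrow> ('a \<times> 'b) set \<Rightarrow> bool" where
  "distance_preserving X d Y e R \<longleftrightarrow>
     R \<subseteq> X \<times> Y \<and> (\<forall>x y x' y'. (x, y) \<in> R \<longrightarrow> (x', y') \<in> R \<longrightarrow> e y y' = d x x')"

lemma distance_preserving_converse:
  "distance_preserving X d Y e R \<Longrightarrow> distance_preserving Y e X d (R\<inverse>)"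
  unfolding distance_preserving_def by auto

lemma distance_preserving_inj:
  assumes "distance_preserving X d Y e R" "ultrametric_space X d" "ultrametric_space Y e"
    and "(x, y) \<in> R" "(x', y') \<in> R"
  shows "x = x' \<longleftrightarrow> y = y'"
proof -
  have "e y y' = d x x'" "x \<in> X" "x' \<in> X" "y \<in> Y" "y' \<in> Y"
    using assms(1,4,5) unfolding distance_preserving_def by auto
  thus ?thesis using ultrametricD(3)[OF assms(2)] ultrametricD(3)[OF assms(3)] by metis
qed

text \<open>
The step where saturation is used: by counting when the distance from \<open>p\<close> to the domain is
attained, by pseudocompleteness when it is not.
\<close>
lemma one_point_extension:
  assumes X: "saturated X d f" and Y: "saturated Y e f"
    and R: "distance_preserving X d Y e R" and p: "p \<in> X"
  shows "\<exists>q\<in>Y. \<forall>x y. (x, y) \<in> R \<longrightarrow> e q y = d p x"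
proof -
  have U: "ultrametric_space X d" "ultrametric_space Y e"
    and B: "branching X d f" "branching Y e f" and C: "pseudocomplete Y e" and Y0: "Y \<noteq> {}"
    using X Y by (auto simp: saturated_def)
  note u = ultrametricD[OF U(1)] and v = ultrametricD[OF U(2)]
  have RXY: "x \<in> X" "y \<in> Y" if "(x, y) \<in> R" for x y
    using R that by (auto simp: distance_preserving_def)
  have Rd: "e y y' = d x x'" if "(x, y) \<in> R" "(x', y') \<in> R" for x y x' y'
    using R that by (auto simp: distance_preserving_def)
  note inj = distance_preserving_inj[OF R U]
  consider "R = {}" | "p \<in> Domain R"
    | x0 y0 where "p \<notin> Domain R" "(x0, y0) \<in> R" "\<And>x y. (x, y) \<in> R \<Longrightarrow> d p x0 \<le> d p x"
    | "R \<noteq> {}" "p \<notin> Domain R" "\<And>x y. (x, y) \<in> R \<Longrightarrow> \<exists>(x', y')\<in>R. d p x' < d p x"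
    by (cases "R = {}"; cases "p \<in> Domain R") (auto simp: not_le[symmetric], blast)
  then show ?thesis
  proof cases
    case 1
    thus ?thesis using Y0 by auto
  next
    case 2
    then obtain q where "(p, q) \<in> R" by auto
    thus ?thesis using RXY(2) Rd by blast
  next
    case (3 x0 y0)
    define r where "r = d p x0"
    have r: "0 < r"
      using 3 p RXY u(1)[of p x0] u(3)[of p x0] by (auto simp: r_def order_less_le)
    \<comment> \<open>Only the points at the minimal distance matter. Their representatives \<open>F\<close> together
      with \<open>p\<close> are still equidistant, so their images do not use up all \<open>f r\<close> open balls.\<close>
    define T where "T = {x \<in> Domain R. d p x = r}"
    have TX: "T \<subseteq> X" using RXY by (auto simp: T_def)
    have "d x x' \<le> r" if "x \<in> T" "x' \<in> T" for x x'
      using u(4)[of x p x'] u(2)[of p x] that TX p by (auto simp: T_def)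
    then obtain F where F: "F \<subseteq> T" "equidistant X d r F" "\<And>x. x \<in> T \<Longrightarrow> \<exists>m\<in>F. d m x < r"
      using equidistant_net[OF U(1) r TX] by metis
    have F0: "F \<noteq> {}" using F(3)[of x0] 3 by (auto simp: T_def r_def)
    have pF: "p \<notin> F" using F(1) 3 by (auto simp: T_def)
    have "equidistant X d r (insert p F)"
      using F(1,2) p u(2) unfolding equidistant_def T_def
      by (smt (verit) insert_iff insert_subset mem_Collect_eq subset_iff)
    hence "card (insert p F) \<le> f r" and fin: "finite F"
      using branchingD[OF B(1) r, of "insert p F"] by auto
    hence cF: "card F < f r" using pF by simp
    have "\<forall>x\<in>Domain R. \<exists>y. (x, y) \<in> R" by blast
    then obtain h where h: "\<And>x. x \<in> Domain R \<Longrightarrow> (x, h x) \<in> R" by (auto dest!: bchoice)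
    have FR: "(x, h x) \<in> R" if "x \<in> F" for x using that F(1) h by (auto simp: T_def)
    have "inj_on h F" using inj FR by (metis inj_onI)
    hence "card (h ` F) < f r" using cF by (simp add: card_image)
    moreover have "equidistant Y e r (h ` F)"
      using F(2) FR RXY(2) Rd unfolding equidistant_def by (auto, metis)
    ultimately obtain q where q: "q \<in> Y" "\<And>y. y \<in> h ` F \<Longrightarrow> e q y = r"
      using branchingD(3)[OF B(2) r, of "h ` F"] F0 by auto
    \<comment> \<open>every point of \<open>T\<close> is within less than \<open>r\<close> of a representative\<close>
    have near: "e q y = r" if xy: "(x, y) \<in> R" and dx: "d p x = r" for x y
    proof -
      obtain m where m: "m \<in> F" "d m x < r" using F(3)[of x] xy dx by (auto simp: T_def)
      have "e y (h m) < r" using Rd[OF xy FR[OF m(1)]] m(2) u(2)[of x m] by simp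
      moreover have "e (h m) q = r" using q(2) m(1) v(2)[of "h m" q] by auto
      ultimately show ?thesis
        using isosceles[OF U(2), of y "h m" q] RXY FR[OF m(1)] xy q(1) v(2)[of q y] by auto
    qed
    \<comment> \<open>points farther away see \<open>p\<close> and \<open>x0\<close> at the same distance\<close>
    have "e q y = d p x" if xy: "(x, y) \<in> R" for x y
    proof (cases "d p x = r")
      case True
      thus ?thesis using near xy by simp
    next
      case False
      hence gt: "r < d p x" using 3(3)[OF xy] by (simp add: r_def)
      have "d x0 x = d p x"
        using isosceles[OF U(1), of x0 p x] gt u(2)[of p x0] RXY(1) xy 3(2) p by (auto simp: r_def)
      hence "e y0 y = d p x" using Rd[OF 3(2) xy] by simp
      moreover have "e q y0 = r" using near[OF 3(2)] by (simp add: r_def)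
      ultimately show ?thesis
        using isosceles[OF U(2), of q y0 y] gt RXY(2) xy 3(2) q(1) by auto
    qed
    thus ?thesis using q(1) by blast
  next
    case 4
    have "\<forall>y\<in>Range R. \<exists>x. (x, y) \<in> R" by blast
    then obtain k where k: "\<And>y. y \<in> Range R \<Longrightarrow> (k y, y) \<in> R" by (auto dest!: bchoice)
    have kx: "k y = x" if "(x, y) \<in> R" for x y using inj[OF k that] that by auto
    obtain q where q: "q \<in> Y" "\<And>y. y \<in> Range R \<Longrightarrow> e q y = d p (k y)"
    proof (rule pseudocompleteD[OF C, of "Range R" "\<lambda>y. d p (k y)"])
      show "Range R \<noteq> {}" "Range R \<subseteq> Y" using 4 RXY by auto
      show "0 < d p (k y)" if "y \<in> Range R" for y
        using u(1)[of p "k y"] u(3)[of p "k y"] p RXY(1) k[OF that] 4(2) by (auto simp: order_less_le)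
      show "\<exists>y'\<in>Range R. d p (k y') < d p (k y)" if "y \<in> Range R" for y
        using 4(3)[OF k[OF that]] kx by auto
      show "e y y' = d p (k y)" if "y \<in> Range R" "y' \<in> Range R" "d p (k y') < d p (k y)" for y y'
        using Rd[OF k[OF that(1)] k[OF that(2)]] isosceles[OF U(1), of "k y'" p "k y"] that(3)
          u(2)[of "k y'"] p RXY(1)[OF k[OF that(1)]] RXY(1)[OF k[OF that(2)]] by auto
    qed blast
    thus ?thesis using kx by (metis Range.intros)
  qed
qed

lemma distance_preserving_insert:
  assumes R: "distance_preserving X d Y e R" and U: "ultrametric_space X d" "ultrametric_space Y e"
    and "p \<in> X" "q \<in> Y" and pq: "\<And>x y. (x, y) \<in> R \<Longrightarrow> e q y = d p x"
  shows "distance_preserving X d Y e (insert (p, q) R)"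
proof -
  have "e y q = d x p" if "(x, y) \<in> R" for x y
    using pq[OF that] ultrametricD(2)[OF U(1), of x p] ultrametricD(2)[OF U(2), of y q] by simp
  moreover have "e q q = d p p"
    using ultrametricD(3)[OF U(1), of p p] ultrametricD(3)[OF U(2), of q q] assms(4,5) by simp
  ultimately show ?thesis using assms unfolding distance_preserving_def by auto
qed

text \<open>
A maximal distance-preserving relation containing the graph of \<open>\<phi>\<close> has full domain and, by
the same argument for its converse, full range.
\<close>
theorem saturated_extend_isometric_map:
  assumes X: "saturated X d f" and Y: "saturated Y e f"
    and S: "S \<subseteq> X" and \<phi>: "isometric_map S d Y e \<phi>"
  obtains \<psi> where "isometry X d Y e \<psi>" "\<And>x. x \<in> S \<Longrightarrow> \<psi> x = \<phi> x"
proof -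
  have U: "ultrametric_space X d" "ultrametric_space Y e" using X Y by (auto simp: saturated_def)
  define G where "G = (\<lambda>x. (x, \<phi> x)) ` S"
  define \<A> where "\<A> = {R. distance_preserving X d Y e R \<and> G \<subseteq> R}"
  have "G \<in> \<A>" using \<phi> S unfolding \<A>_def G_def isometric_map_def distance_preserving_def by auto
  moreover have "\<Union>\<C> \<in> \<A>" if "\<C> \<noteq> {}" "subset.chain \<A> \<C>" for \<C>
  proof -
    have A: "distance_preserving X d Y e R" "G \<subseteq> R" if "R \<in> \<C>" for R
      using that \<open>subset.chain \<A> \<C>\<close> by (auto simp: subset.chain_def \<A>_def)
    have "e y y' = d x x'" if "(x, y) \<in> \<Union>\<C>" "(x', y') \<in> \<Union>\<C>" for x y x' y'
    proof -
      from that(1) obtain P where P: "(x, y) \<in> P" "P \<in> \<C>" by (rule UnionE)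
      from that(2) obtain Q where Q: "(x', y') \<in> Q" "Q \<in> \<C>" by (rule UnionE)
      have "P \<subseteq> Q \<or> Q \<subseteq> P" using \<open>subset.chain \<A> \<C>\<close> P Q by (auto simp: subset_chain_def)
      thus ?thesis using P(1) Q(1) A(1)[OF P(2)] A(1)[OF Q(2)]
        unfolding distance_preserving_def by blast
    qed
    moreover have "\<Union>\<C> \<subseteq> X \<times> Y" using A(1) unfolding distance_preserving_def by blast
    ultimately show ?thesis using A(2) \<open>\<C> \<noteq> {}\<close> unfolding \<A>_def distance_preserving_def by blast
  qed
  ultimately have "\<exists>R\<in>\<A>. \<forall>Q\<in>\<A>. R \<subseteq> Q \<longrightarrow> Q = R"
    by (intro subset_Zorn_nonempty) auto
  then obtain R where "R \<in> \<A>" and max: "\<And>Q. Q \<in> \<A> \<Longrightarrow> R \<subseteq> Q \<Longrightarrow> Q = R" by blast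
  hence R: "distance_preserving X d Y e R" and GR: "G \<subseteq> R" by (auto simp: \<A>_def)
  have ins: "(p, q) \<in> R"
    if "p \<in> X" "q \<in> Y" "\<And>x y. (x, y) \<in> R \<Longrightarrow> e q y = d p x" for p q
    using max[of "insert (p, q) R"] distance_preserving_insert[OF R U that] GR
    by (auto simp: \<A>_def)
  have dom: "\<exists>q. (p, q) \<in> R" if "p \<in> X" for p
    using one_point_extension[OF X Y R that] ins[OF that] by blast
  have ran: "\<exists>p\<in>X. (p, q) \<in> R" if "q \<in> Y" for q
    using one_point_extension[OF Y X distance_preserving_converse[OF R] that] ins[OF _ that]
    by (metis converse_iff)
  obtain \<psi> where \<psi>: "\<And>x. x \<in> X \<Longrightarrow> (x, \<psi> x) \<in> R" using dom by metis
  note inj = distance_preserving_inj[OF R U]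
  have val: "\<psi> x = y" if "(x, y) \<in> R" for x y
    using inj[OF that \<psi>] that R by (auto simp: distance_preserving_def)
  show thesis
  proof
    have "inj_on \<psi> X" using inj \<psi> by (metis inj_onI)
    moreover have "\<psi> ` X = Y"
    proof
      show "\<psi> ` X \<subseteq> Y" using \<psi> R unfolding distance_preserving_def by blast
      show "Y \<subseteq> \<psi> ` X" using ran val by blast
    qed
    moreover have "e (\<psi> x) (\<psi> y) = d x y" if "x \<in> X" "y \<in> X" for x y
      using R \<psi>[OF that(1)] \<psi>[OF that(2)] unfolding distance_preserving_def by blast
    ultimately show "isometry X d Y e \<psi>"
      unfolding isometry_def isometric_map_def bij_betw_def by blast
    show "\<psi> x = \<phi> x" if "x \<in> S" for x using val GR that by (auto simp: G_def)
  qed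
qed

corollary saturated_imp_isometric:
  assumes "saturated X d f" "saturated Y e f"
  shows "isometric_spaces (X, d) (Y, e)"
proof -
  have "isometric_map {} d Y e undefined" by (simp add: isometric_map_def)
  then obtain \<psi> where "isometry X d Y e \<psi>"
    using saturated_extend_isometric_map[OF assms, of "{}"] by auto
  thus ?thesis by (auto simp: isometric_spaces_def)
qed

corollary saturated_imp_absolutely_homogeneous:
  assumes "saturated X d f"
  shows "absolutely_homogeneous X d"
  unfolding absolutely_homogeneous_def
proof (intro allI impI, elim conjE)
  fix S \<phi> assume "S \<subseteq> X" "isometric_map S d X d \<phi>"
  from saturated_extend_isometric_map[OF assms assms this]
  show "\<exists>\<psi>. isometry X d X d \<psi> \<and> (\<forall>x\<in>S. \<psi> x = \<phi> x)" by metis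
qed

section \<open>Absolutely homogeneous spaces are saturated\<close>

lemma homogeneous_extend:
  assumes "absolutely_homogeneous X d" "S \<subseteq> X" "\<And>x. x \<in> S \<Longrightarrow> \<phi> x \<in> X"
    and "\<And>x y. x \<in> S \<Longrightarrow> y \<in> S \<Longrightarrow> d (\<phi> x) (\<phi> y) = d x y"
  obtains \<psi> where "isometry X d X d \<psi>" "\<And>x. x \<in> S \<Longrightarrow> \<psi> x = \<phi> x"
proof -
  have "isometric_map S d X d \<phi>" using assms by (auto simp: isometric_map_def)
  thus thesis using assms(1,2) that unfolding absolutely_homogeneous_def by metis
qed

lemma homogeneous_move_point:
  assumes U: "ultrametric_space X d" and H: "absolutely_homogeneous X d"
    and "x \<in> X" "z \<in> X"
  obtains \<psi> where "isometry X d X d \<psi>" "\<psi> x = z"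
  by (rule homogeneous_extend[OF H, of "{x}" "\<lambda>_. z"])
    (use assms ultrametricD(3)[OF U, of x x] ultrametricD(3)[OF U, of z z] in auto)

text \<open>
If a complete system of representatives \<open>M\<close> were infinite, it would be equinumerous with
\<open>M - {a}\<close>, and equidistance makes the bijection \<open>h\<close> isometric. An isometry extending
\<open>h\<close> hits \<open>a\<close> at some \<open>w\<close> of the ball; but \<open>w\<close> is close to some
\<open>m \<in> M\<close>, so \<open>a\<close> is close to \<open>h m \<noteq> a\<close>, which is impossible.
\<close>
lemma homogeneous_finite_net:
  assumes U: "ultrametric_space X d" and H: "absolutely_homogeneous X d"
    and z: "z \<in> X"
    and M: "equidistant X d t M" "\<And>y. y \<in> M \<Longrightarrow> d z y \<le> t"
      "\<And>y. y \<in> X \<Longrightarrow> d z y \<le> t \<Longrightarrow> \<exists>m\<in>M. d m y < t"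
  shows "finite M"
proof (rule ccontr)
  note u = ultrametricD[OF U]
  have MX: "M \<subseteq> X" using M(1) by (simp add: equidistant_def)
  assume inf: "infinite M"
  then obtain a where a: "a \<in> M" by fastforce
  obtain h where h: "bij_betw h M (M - {a})" using infinite_imp_bij_betw[OF inf] by blast
  have hM: "h x \<in> M" "h x \<noteq> a" if "x \<in> M" for x using h that by (auto simp: bij_betw_def)
  have "d (h x) (h y) = d x y" if "x \<in> M" "y \<in> M" for x y
  proof (cases "x = y")
    case True
    thus ?thesis using u(3) hM(1)[OF that(1)] that MX by (metis subsetD)
  next
    case False
    hence "h x \<noteq> h y" using h that by (metis bij_betw_inv_into_left)
    thus ?thesis using M(1) hM(1) that False by (simp add: equidistant_def)
  qed
  then obtain \<psi> where \<psi>: "isometry X d X d \<psi>" "\<And>x. x \<in> M \<Longrightarrow> \<psi> x = h x"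
    using homogeneous_extend[OF H MX, of h] hM MX by blast
  obtain w where w: "w \<in> X" "\<psi> w = a" using isometryD(3)[OF \<psi>(1)] a MX by blast
  have "d a w = d (h a) a"
    using isometryD(2)[OF \<psi>(1), of a w] \<psi>(2)[OF a] w a MX by auto
  also have "\<dots> = t" using hM[OF a] a M(1) by (simp add: equidistant_def)
  finally have "d z w \<le> t" using u(4)[of z a w] M(2)[OF a] z w(1) a MX by auto
  then obtain m where m: "m \<in> M" "d m w < t" using M(3) w(1) by blast
  have "d (h m) a < t"
    using isometryD(2)[OF \<psi>(1), of m w] \<psi>(2)[OF m(1)] w m MX by auto
  thus False using hM[OF m(1)] a M(1) by (auto simp: equidistant_def)
qed

text \<open>
The number \<open>f t\<close> is read off at one point \<open>z\<close>; an equidistant set located elsewhere is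
first moved to \<open>z\<close> and then compared with the representatives there.
\<close>
lemma homogeneous_imp_branching:
  assumes U: "ultrametric_space X d" and H: "absolutely_homogeneous X d" and X0: "X \<noteq> {}"
  obtains f where "f \<in> index_functions" "branching X d f"
proof -
  note u = ultrametricD[OF U]
  obtain z where z: "z \<in> X" using X0 by auto
  have "\<exists>M. equidistant X d t M \<and> finite M \<and> M \<noteq> {} \<and>
          (\<forall>y\<in>X. d z y \<le> t \<longrightarrow> (\<exists>m\<in>M. d m y < t))" if t: "0 < t" for t
  proof -
    let ?T = "{y \<in> X. d z y \<le> t}"
    have diam: "d x y \<le> t" if "x \<in> ?T" "y \<in> ?T" for x y
      using u(4)[of x z y] u(2)[of x z] that z by auto
    obtain M where M: "M \<subseteq> ?T" "equidistant X d t M" "\<And>y. y \<in> ?T \<Longrightarrow> \<exists>m\<in>M. d m y < t"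
      using equidistant_net[OF U t, of ?T] diam by (metis (no_types, lifting) mem_Collect_eq subsetI)
    have "finite M" by (rule homogeneous_finite_net[OF U H z M(2)]) (use M in auto)
    moreover have "M \<noteq> {}" using M(3)[of z] z u(3)[of z z] t by auto
    ultimately show ?thesis using M by blast
  qed
  then obtain M where M: "\<And>t. 0 < t \<Longrightarrow> equidistant X d t (M t)" "\<And>t. 0 < t \<Longrightarrow> finite (M t)"
      "\<And>t. 0 < t \<Longrightarrow> M t \<noteq> {}"
      "\<And>t y. 0 < t \<Longrightarrow> y \<in> X \<Longrightarrow> d z y \<le> t \<Longrightarrow> \<exists>m\<in>M t. d m y < t"
    by metis
  define f where "f = restrict (\<lambda>t. card (M t)) {0<..}"
  show thesis
  proof
    show "f \<in> index_functions"
      using M(2,3) by (auto simp: f_def index_functions_def Suc_le_eq card_gt_0_iff)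
    show "branching X d f"
      unfolding branching_def
    proof (intro allI impI, elim conjE)
      fix t :: real and E assume t: "0 < t" and E0: "E \<noteq> {}" and E: "equidistant X d t E"
      have EX: "E \<subseteq> X" using E by (simp add: equidistant_def)
      obtain e where e: "e \<in> E" using E0 by auto
      obtain \<psi> where \<psi>: "isometry X d X d \<psi>" "\<psi> e = z"
        using homogeneous_move_point[OF U H _ z, of e] e EX by blast
      have \<psi>X: "\<psi> x \<in> X" if "x \<in> E" for x using isometryD(1)[OF \<psi>(1)] that EX by auto
      have dist: "d (\<psi> x) (\<psi> y) = d x y" if "x \<in> E" "y \<in> E" for x y
        using isometryD(2)[OF \<psi>(1)] that EX by auto
      have "d z (\<psi> x) \<le> t" if "x \<in> E" for x
        using dist[OF e that] \<psi>(2) E that e t u(3)[of x x] EX by (cases "x = e") (auto simp: equidistant_def)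
      hence "\<forall>x\<in>E. \<exists>m. m \<in> M t \<and> d m (\<psi> x) < t" using M(4)[OF t] \<psi>X by blast
      then obtain m where m: "\<And>x. x \<in> E \<Longrightarrow> m x \<in> M t \<and> d (m x) (\<psi> x) < t"
        by (auto dest!: bchoice)
      have MX: "M t \<subseteq> X" using M(1)[OF t] by (simp add: equidistant_def)
      have inj: "inj_on m E"
      proof (rule inj_onI, rule ccontr)
        fix x y assume xy: "x \<in> E" "y \<in> E" "m x = m y" "x \<noteq> y"
        have "d (\<psi> x) (\<psi> y) < t"
          using u(4)[of "\<psi> x" "m x" "\<psi> y"] u(2)[of "\<psi> x" "m x"] m[OF xy(1)] m[OF xy(2)] xy(3)
            \<psi>X xy(1,2) MX by auto
        thus False using dist xy E by (simp add: equidistant_def)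
      qed
      have sub: "m ` E \<subseteq> M t" using m by auto
      show "finite E \<and> card E \<le> f t \<and> (card E < f t \<longrightarrow> (\<exists>q\<in>X. \<forall>y\<in>E. d q y = t))"
      proof (intro conjI impI)
        show "finite E" using inj sub M(2)[OF t] by (metis finite_imageD finite_subset)
        show "card E \<le> f t" using card_inj_on_le[OF inj sub M(2)[OF t]] t by (simp add: f_def)
        assume "card E < f t"
        hence "card (m ` E) < card (M t)" using t card_image[OF inj] by (simp add: f_def)
        then obtain b where b: "b \<in> M t" "b \<notin> m ` E" using sub by (metis less_irrefl subsetI subset_antisym)
        obtain q where q: "q \<in> X" "\<psi> q = b" using isometryD(3)[OF \<psi>(1)] b(1) MX by blast
        have "d q x = t" if x: "x \<in> E" for x
        proof -
          have "m x \<noteq> b" using b(2) x by auto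
          hence "d (m x) b = t" using M(1)[OF t] m[OF x] b(1) by (simp add: equidistant_def)
          hence "d (\<psi> x) b = t"
            using isosceles[OF U, of "\<psi> x" "m x" b] m[OF x] u(2)[of "\<psi> x"] \<psi>X[OF x] MX b(1) by auto
          thus ?thesis using isometryD(2)[OF \<psi>(1), of x q] q x EX u(2)[of q x] by auto
        qed
        thus "\<exists>q\<in>X. \<forall>y\<in>E. d q y = t" using q(1) by blast
      qed
    qed
  qed
qed

text \<open>
The points \<open>y v\<close>, at distance \<open>v\<close> from \<open>z\<close>, form a copy of a transversal
\<open>c v\<close> of \<open>S\<close> for which a pseudolimit, namely \<open>z\<close>, is known. An isometry
taking the copy to the transversal takes \<open>z\<close> to a pseudolimit of \<open>S\<close>.
\<close>
lemma homogeneous_imp_pseudocomplete: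
  assumes U: "ultrametric_space X d" and H: "absolutely_homogeneous X d" and X0: "X \<noteq> {}"
  shows "pseudocomplete X d"
  unfolding pseudocomplete_def
proof (intro allI impI, elim conjE)
  fix S and r :: "'a \<Rightarrow> real"
  assume SX: "S \<subseteq> X"
    and r: "\<forall>s\<in>S. 0 < r s \<and> (\<exists>s'\<in>S. r s' < r s)"
    and lim: "\<forall>s\<in>S. \<forall>s'\<in>S. r s' < r s \<longrightarrow> d s s' = r s"
  note u = ultrametricD[OF U]
  obtain z where z: "z \<in> X" using X0 by auto
  define c where "c = inv_into S r"
  have c: "c v \<in> S \<and> r (c v) = v" if "v \<in> r ` S" for v
    using that by (simp add: c_def inv_into_into f_inv_into_f)
  \<comment> \<open>the distance \<open>v\<close> occurs between two points of \<open>S\<close>; move the first one to \<open>z\<close>\<close>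
  have "\<exists>y\<in>X. d z y = v" if "v \<in> r ` S" for v
  proof -
    from that obtain s where s: "v = r s" "s \<in> S" by (rule imageE)
    then obtain s' where s': "s' \<in> S" "r s' < r s" using r by auto
    with s have "d s s' = v" using lim by auto
    moreover obtain \<psi> where "isometry X d X d \<psi>" "\<psi> s = z"
      using homogeneous_move_point[OF U H _ z, of s] s SX by blast
    ultimately show ?thesis
      using isometryD(1)[of X d X d \<psi> s'] isometryD(2)[of X d X d \<psi> s s'] s s' SX by auto
  qed
  then obtain y where y: "\<And>v. v \<in> r ` S \<Longrightarrow> y v \<in> X \<and> d z (y v) = v" by metis
  have same: "d (c v) (c w) = d (y v) (y w)" if v: "v \<in> r ` S" and w: "w \<in> r ` S" and "w \<le> v" for v w
  proof (cases "w = v")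
    case True
    thus ?thesis using u(3) y[OF v] c[OF v] SX by (metis subsetD)
  next
    case False
    hence "d (c v) (c w) = v" using lim c[OF v] c[OF w] \<open>w \<le> v\<close> by auto
    moreover have "d (y w) (y v) = v"
      using isosceles[OF U, of "y w" z "y v"] y[OF v] y[OF w] u(2)[of z "y w"] z False \<open>w \<le> v\<close> by auto
    ultimately show ?thesis using u(2)[of "y w"] by simp
  qed
  have "d (c v) (c w) = d (y v) (y w)" if "v \<in> r ` S" "w \<in> r ` S" for v w
    using same[OF that] same[OF that(2,1)] u(2)[of "c v"] u(2)[of "y v"] by (metis linear)
  then obtain \<psi> where \<psi>: "isometry X d X d \<psi>" "\<And>x. x \<in> y ` r ` S \<Longrightarrow> \<psi> x = c (d z x)"
    using homogeneous_extend[OF H, of "y ` r ` S" "\<lambda>x. c (d z x)"] y c SX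
    by (smt (verit, best) imageE image_subset_iff subsetD)
  have centre: "d (\<psi> z) (c v) = v" if "v \<in> r ` S" for v
    using isometryD(2)[OF \<psi>(1) z, of "y v"] \<psi>(2)[of "y v"] y[OF that] that by auto
  have \<psi>z: "\<psi> z \<in> X" using isometryD(1)[OF \<psi>(1) z] .
  \<comment> \<open>points of \<open>S\<close> outside the transversal are reached through a closer transversal point\<close>
  have "d (\<psi> z) s = r s" if s: "s \<in> S" for s
  proof -
    obtain s' where s': "s' \<in> S" "r s' < r s" using r s by auto
    let ?w = "c (r s')"
    have w: "?w \<in> S" "r ?w = r s'" using c s' by auto
    hence "d s ?w = r s" using lim s s' by auto
    thus ?thesis
      using isosceles[OF U, of "\<psi> z" ?w s] centre[of "r s'"] u(2)[of s] \<psi>z w(1) s s' SX by auto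
  qed
  thus "\<exists>q\<in>X. \<forall>s\<in>S. d q s = r s" using \<psi>z by blast
qed

theorem homogeneous_imp_saturated:
  assumes "X \<noteq> {}" "ultrametric_space X d" "absolutely_homogeneous X d"
  obtains f where "f \<in> index_functions" "saturated X d f"
  using homogeneous_imp_branching[OF assms(2,3,1)] homogeneous_imp_pseudocomplete[OF assms(2,3,1)]
    assms that unfolding saturated_def by blast

section \<open>The products are saturated\<close>

lemma well_ordered_geD:
  "well_ordered_ge T \<Longrightarrow> S \<subseteq> T \<Longrightarrow> S \<noteq> {} \<Longrightarrow> \<exists>m\<in>S. \<forall>s\<in>S. s \<le> m"
  unfolding well_ordered_ge_def by (elim allE[of _ S]) simp

lemma well_ordered_ge_subset: "well_ordered_ge T \<Longrightarrow> S \<subseteq> T \<Longrightarrow> well_ordered_ge S"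
  unfolding well_ordered_ge_def by blast

lemma well_ordered_ge_Un:
  assumes "well_ordered_ge A" "well_ordered_ge B"
  shows "well_ordered_ge (A \<union> B)"
  unfolding well_ordered_ge_def
proof (intro allI impI, elim conjE)
  fix S assume S: "S \<subseteq> A \<union> B" "S \<noteq> {}"
  have max: "\<exists>m\<in>S \<inter> C. \<forall>s\<in>S \<inter> C. s \<le> m" if "well_ordered_ge C" "S \<inter> C \<noteq> {}" for C
    using that by (intro well_ordered_geD[of C]) auto
  consider "S \<inter> A = {}" | "S \<inter> B = {}" | "S \<inter> A \<noteq> {}" "S \<inter> B \<noteq> {}" by auto
  then show "\<exists>m\<in>S. \<forall>s\<in>S. s \<le> m"
  proof cases
    case 1
    thus ?thesis using max[OF assms(2)] S by blast
  next
    case 2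
    thus ?thesis using max[OF assms(1)] S by blast
  next
    case 3
    then obtain m n where "m \<in> S" "\<forall>s\<in>S \<inter> A. s \<le> m" "n \<in> S" "\<forall>s\<in>S \<inter> B. s \<le> n"
      using max assms by (meson IntD1)
    moreover have "max m n \<in> S" using \<open>m \<in> S\<close> \<open>n \<in> S\<close> by (simp add: max_def)
    ultimately show ?thesis using S(1) by (intro bexI[of _ "max m n"]) (auto simp: le_max_iff_disj)
  qed
qed

text \<open>
Two elements can only differ where one of them differs from the base point \<open>a\<close>, and a union of
two well-ordered sets is well-ordered.
\<close>
lemma product_greatest_difference:
  assumes "x \<in> product_carrier f a" "y \<in> product_carrier f a" "x \<noteq> y"
  obtains l where "0 < l" "x l \<noteq> y l" "\<And>t. l < t \<Longrightarrow> x t = y t"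
proof -
  let ?D = "{t. 0 < t \<and> x t \<noteq> y t}"
  have "well_ordered_ge ({t. 0 < t \<and> x t \<noteq> a t} \<union> {t. 0 < t \<and> y t \<noteq> a t})"
    using assms(1,2) by (intro well_ordered_ge_Un) (auto simp: product_carrier_def)
  hence "well_ordered_ge ?D" by (rule well_ordered_ge_subset) auto
  moreover have "?D \<noteq> {}"
  proof -
    have "x \<in> full_product f" "y \<in> full_product f" using assms by (auto simp: product_carrier_def)
    hence "x = y" if "\<And>t. t \<in> {0<..} \<Longrightarrow> x t = y t"
      using that unfolding full_product_def by (rule PiE_ext)
    thus ?thesis using assms(3) by auto
  qed
  ultimately have "\<exists>l\<in>?D. \<forall>t\<in>?D. t \<le> l" by (rule well_ordered_geD[OF _ subset_refl])
  then obtain l where l: "l \<in> ?D" "\<And>t. t \<in> ?D \<Longrightarrow> t \<le> l" by blast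
  show thesis
  proof
    show "0 < l" "x l \<noteq> y l" using l(1) by auto
    show "x t = y t" if "l < t" for t using l(2)[of t] l(1) that by force
  qed
qed

lemma product_dist_eqI:
  assumes "x \<in> product_carrier f a" "y \<in> product_carrier f a"
    and "0 < l" "x l \<noteq> y l" "\<And>t. l < t \<Longrightarrow> x t = y t"
  shows "product_dist f a x y = l"
proof -
  have "(GREATEST t. 0 < t \<and> x t \<noteq> y t) = l"
    using assms(3-5) by (intro Greatest_equality) (auto simp: not_le[symmetric])
  thus ?thesis using assms(1,2,4) by (auto simp: product_dist_def discrete_metric.dd_def)
qed

text \<open>
In this form the ultrametric inequality is the transitivity of agreement above \<open>r\<close>.
\<close>
lemma product_dist_le_iff:
  assumes "x \<in> product_carrier f a" "y \<in> product_carrier f a" "0 \<le> r"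
  shows "product_dist f a x y \<le> r \<longleftrightarrow> (\<forall>t>r. x t = y t)"
proof (cases "x = y")
  case True
  thus ?thesis using assms(3) by (simp add: product_dist_def)
next
  case False
  then obtain l where l: "0 < l" "x l \<noteq> y l" "\<And>t. l < t \<Longrightarrow> x t = y t"
    using product_greatest_difference[OF assms(1,2)] by blast
  show ?thesis using product_dist_eqI[OF assms(1,2) l] l by (metis linorder_not_less order_le_less_trans)
qed

lemma product_dist_eq_iff:
  assumes "x \<in> product_carrier f a" "y \<in> product_carrier f a" "0 < l"
  shows "product_dist f a x y = l \<longleftrightarrow> x l \<noteq> y l \<and> (\<forall>t>l. x t = y t)"
proof
  assume eq: "product_dist f a x y = l"
  hence "x \<noteq> y" using assms(3) by (auto simp: product_dist_def)
  then obtain k where k: "0 < k" "x k \<noteq> y k" "\<And>t. k < t \<Longrightarrow> x t = y t"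
    using product_greatest_difference[OF assms(1,2)] by blast
  thus "x l \<noteq> y l \<and> (\<forall>t>l. x t = y t)" using product_dist_eqI[OF assms(1,2) k] eq by simp
qed (use product_dist_eqI[OF assms] in auto)

lemma product_dist_commute: "product_dist f a x y = product_dist f a y x"
proof -
  have "(\<lambda>t. 0 < t \<and> x t \<noteq> y t) = (\<lambda>t. 0 < t \<and> y t \<noteq> x t)" by auto
  thus ?thesis by (auto simp: product_dist_def Let_def discrete_metric.dd_def)
qed

lemma product_dist_nonneg: "0 \<le> product_dist f a x y"
proof (cases "x \<in> product_carrier f a \<and> y \<in> product_carrier f a \<and> x \<noteq> y")
  case True
  then obtain l where "0 < l" "x l \<noteq> y l" "\<And>t. l < t \<Longrightarrow> x t = y t"
    using product_greatest_difference by metis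
  thus ?thesis using product_dist_eqI[of x f a y l] True by auto
qed (simp only: product_dist_def if_False order_refl)

lemma product_ultrametric: "ultrametric_space (product_carrier f a) (product_dist f a)"
proof -
  let ?W = "product_carrier f a" and ?dist = "product_dist f a"
  have ultra: "?dist x z \<le> max (?dist x y) (?dist y z)" if "x \<in> ?W" "y \<in> ?W" "z \<in> ?W" for x y z
  proof -
    let ?r = "max (?dist x y) (?dist y z)"
    have r: "0 \<le> ?r" using product_dist_nonneg[of f a x y] by linarith
    have "\<forall>t>?r. x t = y t" "\<forall>t>?r. y t = z t"
      using product_dist_le_iff[OF _ _ r] that by (metis max.cobounded1, metis max.cobounded2)
    thus ?thesis using product_dist_le_iff[OF that(1,3) r] by simp
  qed
  have "Metric_space ?W ?dist"
  proof
    show "0 \<le> ?dist x y" for x y by (rule product_dist_nonneg)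
    show "?dist x y = ?dist y x" for x y by (rule product_dist_commute)
    show "?dist x y = 0 \<longleftrightarrow> x = y" if "x \<in> ?W" "y \<in> ?W" for x y
    proof
      assume "?dist x y = 0"
      show "x = y"
      proof (rule ccontr)
        assume "x \<noteq> y"
        from product_greatest_difference[OF that this]
        obtain l where "0 < l" "x l \<noteq> y l" "\<And>t. l < t \<Longrightarrow> x t = y t"
          by blast
        from product_dist_eqI[OF that this] \<open>?dist x y = 0\<close> \<open>0 < l\<close> show False by simp
      qed
    qed (simp add: product_dist_def)
    show "?dist x z \<le> ?dist x y + ?dist y z" if "x \<in> ?W" "y \<in> ?W" "z \<in> ?W" for x y z
      using ultra[OF that] product_dist_nonneg[of f a x y] product_dist_nonneg[of f a y z]
      by linarith
  qed
  thus ?thesis using ultra by (auto simp: ultrametric_space_def)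
qed

text \<open>
The members of a \<open>t\<close>-equidistant set agree above \<open>t\<close> and are told apart by their
\<open>t\<close>-th coordinates in \<open>{1..f t}\<close>; a coordinate value that does not occur yields a
further member.
\<close>
lemma product_branching: "branching (product_carrier f a) (product_dist f a) f"
  unfolding branching_def
proof (intro allI impI, elim conjE)
  let ?W = "product_carrier f a" and ?dist = "product_dist f a"
  fix t :: real and E assume t: "0 < t" and "E \<noteq> {}" and E: "equidistant ?W ?dist t E"
  have EW: "E \<subseteq> ?W" using E by (simp add: equidistant_def)
  have differ: "x t \<noteq> y t \<and> (\<forall>s>t. x s = y s)" if "x \<in> E" "y \<in> E" "x \<noteq> y" for x y
    using product_dist_eq_iff[of x f a y t] E EW that t by (auto simp: equidistant_def)
  have inj: "inj_on (\<lambda>x. x t) E" using differ by (meson inj_onI)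
  have sub: "(\<lambda>x. x t) ` E \<subseteq> {1..f t}"
    using EW t by (fastforce simp: product_carrier_def full_product_def)
  show "finite E \<and> card E \<le> f t \<and> (card E < f t \<longrightarrow> (\<exists>q\<in>?W. \<forall>y\<in>E. ?dist q y = t))"
  proof (intro conjI impI)
    show "finite E" using inj sub by (metis finite_imageD finite_subset finite_atLeastAtMost)
    show "card E \<le> f t" using card_inj_on_le[OF inj sub] by simp
    assume "card E < f t"
    hence "(\<lambda>x. x t) ` E \<noteq> {1..f t}" using card_image[OF inj] by auto
    then obtain v where v: "v \<in> {1..f t}" "\<And>x. x \<in> E \<Longrightarrow> x t \<noteq> v" using sub by fastforce
    obtain e where e: "e \<in> E" using \<open>E \<noteq> {}\<close> by auto
    define q where "q = e(t := v)"
    have "e \<in> ?W" using e EW by auto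
    have "well_ordered_ge {t}" by (auto simp: well_ordered_ge_def subset_singleton_iff)
    hence "well_ordered_ge ({s. 0 < s \<and> e s \<noteq> a s} \<union> {t})"
      using \<open>e \<in> ?W\<close> by (intro well_ordered_ge_Un) (auto simp: product_carrier_def)
    hence "well_ordered_ge {s. 0 < s \<and> q s \<noteq> a s}"
      by (rule well_ordered_ge_subset) (auto simp: q_def)
    moreover have "q \<in> full_product f"
      using \<open>e \<in> ?W\<close> v(1) t unfolding q_def product_carrier_def full_product_def
      by (auto simp: PiE_iff extensional_def)
    ultimately have q: "q \<in> ?W" by (simp add: product_carrier_def)
    have "?dist q x = t" if "x \<in> E" for x
      using product_dist_eq_iff[OF q, of x t] differ[OF e that] v(2)[OF that] that EW t
      by (cases "e = x") (auto simp: q_def)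
    thus "\<exists>q\<in>?W. \<forall>y\<in>E. ?dist q y = t" using q by blast
  qed
qed

text \<open>
All \<open>s \<in> S\<close> with \<open>r s < t\<close> have the same \<open>t\<close>-th coordinate, which becomes that
of the pseudolimit \<open>q\<close>; where there is no such \<open>s\<close>, the coordinate of \<open>a\<close> serves.
\<close>
lemma product_pseudocomplete:
  assumes a: "a \<in> full_product f"
  shows "pseudocomplete (product_carrier f a) (product_dist f a)"
  unfolding pseudocomplete_def
proof (intro allI impI, elim conjE)
  let ?W = "product_carrier f a" and ?dist = "product_dist f a"
  note U = product_ultrametric[of f a]
  fix S and r :: "(real \<Rightarrow> nat) \<Rightarrow> real"
  assume SW: "S \<subseteq> ?W"
    and r: "\<forall>s\<in>S. 0 < r s \<and> (\<exists>s'\<in>S. r s' < r s)"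
    and lim: "\<forall>s\<in>S. \<forall>s'\<in>S. r s' < r s \<longrightarrow> ?dist s s' = r s"
  have less: "s t = s' t" if "s \<in> S" "s' \<in> S" "r s' < r s" "r s < t" for s s' t
    using lim r product_dist_eq_iff[of s f a s' "r s"] SW that by (metis subsetD)
  have agree: "s t = s' t" if "s \<in> S" "s' \<in> S" "r s < t" "r s' < t" for s s' t
  proof (cases "r s = r s'")
    case True
    from that(1) r obtain s'' where s'': "s'' \<in> S" "r s'' < r s" by auto
    have "s t = s'' t" using less[OF that(1) s''(1,2) that(3)] .
    moreover have "s' t = s'' t" using less[OF that(2) s''(1) _ that(4)] s''(2) True by simp
    ultimately show ?thesis by simp
  next
    case False
    thus ?thesis using less that by (metis linorder_neqE)
  qed
  define q where "q t = (if \<exists>s\<in>S. r s < t then (SOME s. s \<in> S \<and> r s < t) t else a t)" for t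
  have q_eq: "q t = s t" if s: "s \<in> S" "r s < t" for s t
  proof -
    have "(SOME s. s \<in> S \<and> r s < t) \<in> S \<and> r (SOME s. s \<in> S \<and> r s < t) < t"
      by (rule someI[of _ s]) (use s in auto)
    thus ?thesis using s agree unfolding q_def by auto
  qed
  have q: "q \<in> ?W"
    unfolding product_carrier_def
  proof (intro CollectI conjI)
    have "q t = a t \<or> (\<exists>s\<in>S. q t = s t \<and> 0 < t)" for t
    proof (cases "\<exists>s\<in>S. r s < t")
      case True
      then obtain s where "s \<in> S" "r s < t" by auto
      thus ?thesis using q_eq r by (metis order_less_trans)
    qed (simp add: q_def)
    thus "q \<in> full_product f"
      using a SW unfolding full_product_def product_carrier_def PiE_iff extensional_def
      by (smt (verit, best) greaterThan_iff mem_Collect_eq subsetD)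
    show "well_ordered_ge {t. 0 < t \<and> q t \<noteq> a t}"
      unfolding well_ordered_ge_def
    proof (intro allI impI, elim conjE)
      fix T assume T: "T \<subseteq> {t. 0 < t \<and> q t \<noteq> a t}" "T \<noteq> {}"
      then obtain t0 where t0: "t0 \<in> T" by auto
      hence "q t0 \<noteq> a t0" using T by auto
      then obtain s where s: "s \<in> S" "r s < t0" unfolding q_def by (meson)
      \<comment> \<open>above \<open>r s\<close> the point \<open>q\<close> coincides with \<open>s\<close>, so this upper section of
        \<open>T\<close> has a maximum; it is then the maximum of \<open>T\<close>\<close>
      have "T \<inter> {r s<..} \<subseteq> {t. 0 < t \<and> s t \<noteq> a t}" using T(1) q_eq[OF s(1)] by auto
      moreover have "well_ordered_ge {t. 0 < t \<and> s t \<noteq> a t}"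
        using s(1) SW by (auto simp: product_carrier_def)
      moreover have "T \<inter> {r s<..} \<noteq> {}" using t0 s(2) by auto
      ultimately have "\<exists>m\<in>T \<inter> {r s<..}. \<forall>t\<in>T \<inter> {r s<..}. t \<le> m" by (intro well_ordered_geD)
      then obtain m where "m \<in> T \<inter> {r s<..}" "\<forall>t\<in>T \<inter> {r s<..}. t \<le> m" by blast
      thus "\<exists>m\<in>T. \<forall>t\<in>T. t \<le> m" by (intro bexI[of _ m]) force+
    qed
  qed
  have "?dist q s = r s" if s: "s \<in> S" for s
  proof -
    obtain s' where s': "s' \<in> S" "r s' < r s" using r s by auto
    have "?dist q s' \<le> r s'"
      using product_dist_le_iff[OF q, of s' "r s'"] q_eq[OF s'(1)] s'(1) r SW by (auto simp: less_imp_le)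
    moreover have "?dist s' s = r s" using lim s s' product_dist_commute by metis
    ultimately show ?thesis using isosceles[OF U, of q s' s] q s s' SW by auto
  qed
  thus "\<exists>q\<in>?W. \<forall>s\<in>S. ?dist q s = r s" using q by blast
qed

theorem product_saturated:
  assumes "a \<in> full_product f"
  shows "saturated (product_carrier f a) (product_dist f a) f"
proof -
  have "a \<in> product_carrier f a" using assms by (simp add: product_carrier_def well_ordered_ge_def)
  thus ?thesis
    using product_ultrametric product_branching product_pseudocomplete[OF assms]
    unfolding saturated_def by blast
qed

section \<open>Isometry classes\<close>

lemma isometric_spaces_refl: "isometric_spaces A A"
  unfolding isometric_spaces_def isometry_def isometric_map_def by (intro exI[of _ id]) auto

lemma isometric_spaces_sym:
  assumes "isometric_spaces A B" shows "isometric_spaces B A"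
proof -
  obtain \<psi> where \<psi>: "isometry (fst A) (snd A) (fst B) (snd B) \<psi>"
    using assms by (auto simp: isometric_spaces_def)
  hence b: "bij_betw \<psi> (fst A) (fst B)" by (simp add: isometry_def)
  let ?\<phi> = "inv_into (fst A) \<psi>"
  have \<phi>: "?\<phi> y \<in> fst A" "\<psi> (?\<phi> y) = y" if "y \<in> fst B" for y
    using b that by (auto simp: bij_betw_def inv_into_into f_inv_into_f)
  have "isometry (fst B) (snd B) (fst A) (snd A) ?\<phi>"
    using bij_betw_inv_into[OF b] \<phi> isometryD(2)[OF \<psi>]
    unfolding isometry_def isometric_map_def by (metis Pi_I)
  thus ?thesis by (auto simp: isometric_spaces_def)
qed

lemma isometric_spaces_trans:
  assumes "isometric_spaces A B" "isometric_spaces B C" shows "isometric_spaces A C"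
proof -
  obtain \<psi> \<phi> where "isometry (fst A) (snd A) (fst B) (snd B) \<psi>"
      "isometry (fst B) (snd B) (fst C) (snd C) \<phi>"
    using assms by (auto simp: isometric_spaces_def)
  hence "isometry (fst A) (snd A) (fst C) (snd C) (\<phi> \<circ> \<psi>)"
    unfolding isometry_def isometric_map_def by (auto intro: bij_betw_trans simp: Pi_iff)
  thus ?thesis by (auto simp: isometric_spaces_def)
qed

lemma equiv_AHU_isometry_rel: "equiv AHU_spaces AHU_isometry_rel"
proof (rule equivI)
  show "AHU_isometry_rel \<subseteq> AHU_spaces \<times> AHU_spaces" by (auto simp: AHU_isometry_rel_def)
  show "refl_on AHU_spaces AHU_isometry_rel"
    by (auto simp: refl_on_def AHU_isometry_rel_def isometric_spaces_refl)
  show "sym AHU_isometry_rel"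
    by (auto simp: sym_def AHU_isometry_rel_def intro: isometric_spaces_sym)
  show "trans AHU_isometry_rel"
    by (auto simp: trans_def AHU_isometry_rel_def intro: isometric_spaces_trans)
qed

text \<open>
An isometry carries equidistant sets to equidistant sets, so it preserves their largest size. Outside
\<open>(0, \<infinity>)\<close> both functions are \<open>undefined\<close>.
\<close>
lemma saturated_index_unique:
  assumes "saturated X d f" "saturated Y e g" "isometric_spaces (X, d) (Y, e)"
    and "f \<in> index_functions" "g \<in> index_functions"
  shows "f = g"
proof -
  have le: "h t \<le> k t" if "saturated V v h" "saturated W w k" "isometric_spaces (V, v) (W, w)" "0 < t"
    for V :: "'c set" and v and W :: "'d set" and w h k t
    using branching_numbers_le[OF that(1) _ _ that(4)] that(2,3)
    by (auto simp: saturated_def isometric_spaces_def)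
  have "f t = g t" if "0 < t" for t
    using le[OF assms(1-3) that] le[OF assms(2,1) isometric_spaces_sym[OF assms(3)] that] by simp
  thus ?thesis using assms(4,5) unfolding index_functions_def by (auto intro: PiE_ext)
qed

lemma product_space_AHU:
  assumes "a \<in> full_product f"
  shows "product_space f a \<in> AHU_spaces"
  using product_saturated[OF assms] saturated_imp_absolutely_homogeneous[OF product_saturated[OF assms]]
  by (simp add: AHU_spaces_def product_space_def saturated_def)

lemma AHU_space_isometric_product:
  assumes "Z \<noteq> {}" "ultrametric_space Z \<rho>" "absolutely_homogeneous Z \<rho>"
  obtains f where "f \<in> index_functions"
    "\<And>a. a \<in> full_product f \<Longrightarrow> isometric_spaces (Z, \<rho>) (product_space f a)"
    "\<And>g b. g \<in> index_functions \<Longrightarrow> b \<in> full_product g \<Longrightarrow>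
       isometric_spaces (Z, \<rho>) (product_space g b) \<Longrightarrow> g = f"
proof -
  obtain f where f: "f \<in> index_functions" "saturated Z \<rho> f"
    using homogeneous_imp_saturated[OF assms] .
  show thesis
  proof
    show "f \<in> index_functions" by (rule f)
    show "isometric_spaces (Z, \<rho>) (product_space f a)" if "a \<in> full_product f" for a
      unfolding product_space_def
      by (rule saturated_imp_isometric[OF f(2) product_saturated[OF that]])
    show "g = f" if "g \<in> index_functions" "b \<in> full_product g"
      "isometric_spaces (Z, \<rho>) (product_space g b)" for g b
      by (rule saturated_index_unique[OF f(2) product_saturated[OF that(2)]
            that(3)[unfolded product_space_def] f(1) that(1), symmetric])
  qed
qed

lemma isometric_products_imp_eq:
  assumes "f \<in> index_functions" "g \<in> index_functions" "a \<in> full_product f" "b \<in> full_product g"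
    and "isometric_spaces (product_space f a) (product_space g b)"
  shows "f = g"
  by (rule saturated_index_unique[OF product_saturated[OF assms(3)] product_saturated[OF assms(4)]
        assms(5)[unfolded product_space_def] assms(1,2)])

lemma bij_betw_AHU_classes:
  fixes a :: "(real \<Rightarrow> nat) \<Rightarrow> real \<Rightarrow> nat"
  assumes a: "\<And>f. f \<in> index_functions \<Longrightarrow> a f \<in> full_product f"
  shows "bij_betw (\<lambda>f. AHU_isometry_rel `` {product_space f (a f)}) index_functions
           (AHU_spaces // AHU_isometry_rel)"
  unfolding bij_betw_def
proof (intro conjI inj_onI subset_antisym subsetI)
  fix f g assume fg: "f \<in> index_functions" "g \<in> index_functions"
    and "AHU_isometry_rel `` {product_space f (a f)} = AHU_isometry_rel `` {product_space g (a g)}"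
  hence "(product_space f (a f), product_space g (a g)) \<in> AHU_isometry_rel"
    using eq_equiv_class[OF _ equiv_AHU_isometry_rel product_space_AHU[OF a[OF fg(2)]]] by blast
  hence "isometric_spaces (product_space f (a f)) (product_space g (a g))"
    by (simp add: AHU_isometry_rel_def)
  thus "f = g" by (rule isometric_products_imp_eq[OF fg a[OF fg(1)] a[OF fg(2)]])
next
  fix c assume "c \<in> (\<lambda>f. AHU_isometry_rel `` {product_space f (a f)}) ` index_functions"
  then obtain f where "f \<in> index_functions" "c = AHU_isometry_rel `` {product_space f (a f)}"
    by blast
  thus "c \<in> AHU_spaces // AHU_isometry_rel" using product_space_AHU[OF a] by (simp add: quotientI)
next
  fix c :: "((real \<Rightarrow> nat) set \<times> ((real \<Rightarrow> nat) \<Rightarrow> (real \<Rightarrow> nat) \<Rightarrow> real)) set"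
  assume "c \<in> AHU_spaces // AHU_isometry_rel"
  then obtain A where A: "A \<in> AHU_spaces" "c = AHU_isometry_rel `` {A}" by (rule quotientE)
  obtain Z \<rho> where Z: "A = (Z, \<rho>)" by (cases A)
  have Z': "Z \<noteq> {}" "ultrametric_space Z \<rho>" "absolutely_homogeneous Z \<rho>"
    using A(1) Z by (auto simp: AHU_spaces_def)
  obtain f where f: "f \<in> index_functions"
      "\<And>b. b \<in> full_product f \<Longrightarrow> isometric_spaces (Z, \<rho>) (product_space f b)"
    using AHU_space_isometric_product[OF Z'] by metis
  have "(A, product_space f (a f)) \<in> AHU_isometry_rel"
    using A(1) product_space_AHU[OF a[OF f(1)]] f(2)[OF a[OF f(1)]] Z
    by (simp add: AHU_isometry_rel_def)
  hence "c = AHU_isometry_rel `` {product_space f (a f)}"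
    using A(2) equiv_class_eq[OF equiv_AHU_isometry_rel] by blast
  thus "c \<in> (\<lambda>f. AHU_isometry_rel `` {product_space f (a f)}) ` index_functions"
    using f(1) by (rule image_eqI)
qed

theorem corollary5p16:
  shows
    "(\<forall>a. (\<forall>f\<in>index_functions. a f \<in> full_product f) \<longrightarrow>
        bij_betw (\<lambda>f. AHU_isometry_rel `` {product_space f (a f)})
          index_functions
          ((AHU_spaces :: ((real \<Rightarrow> nat) set \<times> ((real \<Rightarrow> nat) \<Rightarrow> (real \<Rightarrow> nat) \<Rightarrow> real)) set)
             // AHU_isometry_rel))
   \<and> (\<forall>(Z :: 'a set) \<rho>.
        Z \<noteq> {} \<and> ultrametric_space Z \<rho> \<and> absolutely_homogeneous Z \<rho> \<longrightarrow>
        (\<exists>f\<in>index_functions.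
           (\<forall>a\<in>full_product f. isometric_spaces (Z, \<rho>) (product_space f a)) \<and>
           (\<forall>g\<in>index_functions. \<forall>b\<in>full_product g.
              isometric_spaces (Z, \<rho>) (product_space g b) \<longrightarrow> g = f)))
   \<and> (\<forall>f\<in>index_functions. \<forall>a\<in>full_product f.
        product_carrier f a \<noteq> {} \<and>
        ultrametric_space (product_carrier f a) (product_dist f a) \<and>
        absolutely_homogeneous (product_carrier f a) (product_dist f a))"
proof (intro conjI)
  show "(\<forall>a. (\<forall>f\<in>index_functions. a f \<in> full_product f) \<longrightarrow>
        bij_betw (\<lambda>f. AHU_isometry_rel `` {product_space f (a f)})
          index_functions
          ((AHU_spaces :: ((real \<Rightarrow> nat) set \<times> ((real \<Rightarrow> nat) \<Rightarrow> (real \<Rightarrow> nat) \<Rightarrow> real)) set)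
             // AHU_isometry_rel))"
    using bij_betw_AHU_classes by simp
  show "(\<forall>(Z :: 'a set) \<rho>.
        Z \<noteq> {} \<and> ultrametric_space Z \<rho> \<and> absolutely_homogeneous Z \<rho> \<longrightarrow>
        (\<exists>f\<in>index_functions.
           (\<forall>a\<in>full_product f. isometric_spaces (Z, \<rho>) (product_space f a)) \<and>
           (\<forall>g\<in>index_functions. \<forall>b\<in>full_product g.
              isometric_spaces (Z, \<rho>) (product_space g b) \<longrightarrow> g = f)))"
    using AHU_space_isometric_product by metis
  show "(\<forall>f\<in>index_functions. \<forall>a\<in>full_product f.
        product_carrier f a \<noteq> {} \<and>
        ultrametric_space (product_carrier f a) (product_dist f a) \<and>
        absolutely_homogeneous (product_carrier f a) (product_dist f a))"
    using product_space_AHU by (simp add: AHU_spaces_def product_space_def)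
qed

end
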